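(* Let $\varphi$ be a monotone DNF (resp. a monotone CNF), let $a$ be its arity and $d$ its degree. Then any d-SDNNF (resp. any SDNNF) for $\varphi$ has size at least $$2^{\left\lfloor\frac{\mathrm{tw}(\varphi)}{3\times a^3\times d^2}\right\rfloor}-1.$$
   Context: A monotone DNF (resp. monotone CNF) on a finite set of variables $V$ is a disjunction of conjunctions (resp. conjunction of disjunctions) of variables of $V$; each such conjunction (resp. disjunction) is a clause, identified with the set of variables it contains. Monotone DNFs and CNFs are always assumed minimized (no clause is a subset of another) and to contain at least one non-empty clause. The hypergraph of $\varphi$ has the variables as vertices and the clauses as hyperedges. The arity of $\varphi$ is the maximal size of a hyperedge; the degree is the maximal number of hyperedges containing a given vertex. $\mathrm{tw}(\varphi)$ is the treewidth of the hypergraph of $\varphi$: the minimal width of a tree decomposition, i.e. of a tree whose nodes (bags) are labeled by subsets of the vertices such that every hyperedge is contained in some bag and for each vertex the bags containing it form a connected subtree; width is the maximal bag size minus one. A Boolean circuit $C=(G,W,g_{\mathrm{output}},\mu)$ is a directed acyclic graph $(G,W)$ of gates and wires, with an output gate and a type in $\{\mathsf{var},\mathsf{not},\mathsf{or},\mathsf{and}\}$ for each gate; the inputs of $g$ are the gates $g'$ with $(g',g)\in W$; $\mathsf{not}$-gates have exactly one input and $\mathsf{var}$-gates none. The function captured by $C$ is the value of the output gate as a function of the valuation of the set $C_{\mathsf{var}}$ of variable gates; $C$ is a circuit for $\varphi$ if it captures the function of $\varphi$. The size of $C$ is that of the graph $(G,W)$. For a gate $g$, $\mathsf{Vars}(g)$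 is the set of variable gates with a directed path to $g$. $C$ is in negation normal form (NNF) if inputs of $\mathsf{not}$-gates are variable gates. A v-tree over $V$ is a rooted ordered binary tree $T$ whose leaves are in bijection with $V$; $\mathsf{Leaves}(T_n)$ is the set of leaves of the subtree $T_n$ rooted at $n$. $T$ structures $C$ if $T$ is over $C_{\mathsf{var}}$ and for every $\mathsf{and}$-gate $g$ with inputs $g_1,\dots,g_m$, $m>0$, there is a node $n\in T$ with $m$ children $n_1,\dots,n_m$ such that $\mathsf{Vars}(g_i)\subseteq\mathsf{Leaves}(T_{n_i})$ for all $i$. An SDNNF is an NNF structured by some v-tree. $C$ is deterministic if for every $\mathsf{or}$-gate, no valuation makes two distinct inputs of it both evaluate to $1$. A d-SDNNF is a deterministic SDNNF. *)

theory Defs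
  imports Main
begin

section \<open>Monotone normal forms and their hypergraphs\<close>

text \<open>
  A monotone DNF or CNF is represented by its set \<open>V\<close> of variables and its set \<open>F\<close> of
  clauses, each clause being the set of its variables. The same pair \<open>(V, F)\<close> is also the
  hypergraph of the formula. The last two conditions together exclude the empty clause.
\<close>

definition monotone_normal_form :: "'v set \<Rightarrow> 'v set set \<Rightarrow> bool" where
  "monotone_normal_form V F \<longleftrightarrow>
     finite V \<and> F \<subseteq> Pow V \<and>
     (\<forall>K\<in>F. \<forall>L\<in>F. K \<subseteq> L \<longrightarrow> K = L) \<and>
     (\<exists>K\<in>F. K \<noteq> {})"

definition dnf_value :: "'v set set \<Rightarrow> ('v \<Rightarrow> bool) \<Rightarrow> bool" where
  "dnf_value F \<nu> \<longleftrightarrow> (\<exists>K\<in>F. \<forall>x\<in>K. \<nu> x)"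

definition cnf_value :: "'v set set \<Rightarrow> ('v \<Rightarrow> bool) \<Rightarrow> bool" where
  "cnf_value F \<nu> \<longleftrightarrow> (\<forall>K\<in>F. \<exists>x\<in>K. \<nu> x)"

definition arity :: "'v set set \<Rightarrow> nat" where
  "arity F = Max (card ` F)"

definition degree :: "'v set \<Rightarrow> 'v set set \<Rightarrow> nat" where
  "degree V F = Max ((\<lambda>x. card {K \<in> F. x \<in> K}) ` V)"


section \<open>Treewidth\<close>

text \<open>
  An undirected graph is a set of nodes together with a symmetric irreflexive edge relation.
\<close>

definition connected_in :: "('n \<times> 'n) set \<Rightarrow> 'n set \<Rightarrow> bool" where
  "connected_in E S \<longleftrightarrow> (\<forall>s\<in>S. \<forall>t\<in>S. (s, t) \<in> (E \<inter> S \<times> S)\<^sup>*)"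

definition is_cycle :: "('n \<times> 'n) set \<Rightarrow> 'n list \<Rightarrow> bool" where
  "is_cycle E p \<longleftrightarrow> 3 \<le> length p \<and> distinct p \<and>
     (\<forall>i<length p. (p ! i, p ! (Suc i mod length p)) \<in> E)"

definition is_tree :: "'n set \<Rightarrow> ('n \<times> 'n) set \<Rightarrow> bool" where
  "is_tree N E \<longleftrightarrow> finite N \<and> N \<noteq> {} \<and> E \<subseteq> N \<times> N \<and> sym E \<and> irrefl E \<and>
     connected_in E N \<and> (\<nexists>p. is_cycle E p)"

text \<open>
  A vertex contained in no hyperedge need not occur in any bag. Since there is a non-empty
  hyperedge, this does not affect the treewidth: such a vertex can always be added in a new
  singleton bag.
\<close>

definition tree_decomposition ::
    "'v set \<Rightarrow> 'v set set \<Rightarrow> 'n set \<Rightarrow> ('n \<times> 'n) set \<Rightarrow> ('n \<Rightarrow> 'v set) \<Rightarrow> bool" where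
  "tree_decomposition V F N E bag \<longleftrightarrow>
     is_tree N E \<and>
     (\<forall>t\<in>N. bag t \<subseteq> V) \<and>
     (\<forall>K\<in>F. \<exists>t\<in>N. K \<subseteq> bag t) \<and>
     (\<forall>x\<in>V. connected_in E {t \<in> N. x \<in> bag t})"

text \<open>
  The subtraction is exact whenever some bag is non-empty, which holds for every tree
  decomposition of a hypergraph with a non-empty hyperedge.
\<close>

definition width :: "'n set \<Rightarrow> ('n \<Rightarrow> 'v set) \<Rightarrow> nat" where
  "width N bag = Max ((\<lambda>t. card (bag t)) ` N) - 1"

text \<open>Every finite tree is isomorphic to one whose nodes are natural numbers.\<close>

definition treewidth :: "'v set \<Rightarrow> 'v set set \<Rightarrow> nat" where
  "treewidth V F =
     (LEAST k. \<exists>(N :: nat set) E bag. tree_decomposition V F N E bag \<and> width N bag = k)"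

text \<open>The minimum is taken over a non-empty set.\<close>

lemma tree_decomposition_single_bag:
  fixes t :: 'n
  assumes "F \<subseteq> Pow V"
  shows "tree_decomposition V F {t} {} (\<lambda>_. V)"
proof -
  have "\<not> is_cycle {} p" for p :: "'n list"
    by (cases p) (auto simp: is_cycle_def)
  then show ?thesis
    using assms
    by (auto simp: tree_decomposition_def is_tree_def connected_in_def sym_def irrefl_def)
qed


section \<open>Boolean circuits\<close>

datatype gate_type = VarGate | NotGate | OrGate | AndGate

record 'g circuit =
  gates :: "'g set"
  wires :: "('g \<times> 'g) set"
  output_gate :: 'g
  gate_type :: "'g \<Rightarrow> gate_type"

definition inputs :: "'g circuit \<Rightarrow> 'g \<Rightarrow> 'g set" where
  "inputs C g = {h. (h, g) \<in> wires C}"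

definition boolean_circuit :: "'g circuit \<Rightarrow> bool" where
  "boolean_circuit C \<longleftrightarrow>
     finite (gates C) \<and> wires C \<subseteq> gates C \<times> gates C \<and> acyclic (wires C) \<and>
     output_gate C \<in> gates C \<and>
     (\<forall>g\<in>gates C. gate_type C g = NotGate \<longrightarrow> (\<exists>h. inputs C g = {h})) \<and>
     (\<forall>g\<in>gates C. gate_type C g = VarGate \<longrightarrow> inputs C g = {})"

definition var_gates :: "'g circuit \<Rightarrow> 'g set" where
  "var_gates C = {g \<in> gates C. gate_type C g = VarGate}"

text \<open>
  A wire goes from the input to the gate that reads it, so \<open>wires C\<close> is the well-founded
  relation of the recursion; see \<open>gate_value_unfold\<close>.
\<close>

definition gate_value :: "'g circuit \<Rightarrow> ('g \<Rightarrow> bool) \<Rightarrow> 'g \<Rightarrow> bool" where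
  "gate_value C \<nu> = wfrec (wires C) (\<lambda>val g.
     case gate_type C g of
       VarGate \<Rightarrow> \<nu> g
     | NotGate \<Rightarrow> (\<forall>h\<in>inputs C g. \<not> val h)
     | OrGate \<Rightarrow> (\<exists>h\<in>inputs C g. val h)
     | AndGate \<Rightarrow> (\<forall>h\<in>inputs C g. val h))"

lemma wf_wires:
  assumes "boolean_circuit C"
  shows "wf (wires C)"
proof (rule finite_acyclic_wf)
  show "finite (wires C)"
    using assms by (auto simp: boolean_circuit_def intro: finite_subset[of _ "gates C \<times> gates C"])
  show "acyclic (wires C)"
    using assms by (simp add: boolean_circuit_def)
qed

lemma gate_value_unfold:
  assumes "boolean_circuit C"
  shows "gate_value C \<nu> g =
    (case gate_type C g of
       VarGate \<Rightarrow> \<nu> g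
     | NotGate \<Rightarrow> (\<forall>h\<in>inputs C g. \<not> gate_value C \<nu> h)
     | OrGate \<Rightarrow> (\<exists>h\<in>inputs C g. gate_value C \<nu> h)
     | AndGate \<Rightarrow> (\<forall>h\<in>inputs C g. gate_value C \<nu> h))"
  unfolding gate_value_def
  by (subst wfrec[OF wf_wires[OF assms]])
    (auto simp: inputs_def cut_apply split: gate_type.split)

text \<open>
  The variables of a circuit are its variable gates themselves. A function over the variables
  \<open>V\<close> can only be captured by a circuit whose set of variable gates is exactly \<open>V\<close>.
\<close>

definition captures :: "'v circuit \<Rightarrow> 'v set \<Rightarrow> (('v \<Rightarrow> bool) \<Rightarrow> bool) \<Rightarrow> bool" where
  "captures C V f \<longleftrightarrow> var_gates C = V \<and> (\<forall>\<nu>. gate_value C \<nu> (output_gate C) = f \<nu>)"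

text \<open>
  Wires are not counted, so that a lower bound on this size is also one on the number of gates
  plus wires.
\<close>

definition circuit_size :: "'g circuit \<Rightarrow> nat" where
  "circuit_size C = card (gates C)"

definition Vars :: "'g circuit \<Rightarrow> 'g \<Rightarrow> 'g set" where
  "Vars C g = {x \<in> var_gates C. (x, g) \<in> (wires C)\<^sup>*}"

definition is_NNF :: "'g circuit \<Rightarrow> bool" where
  "is_NNF C \<longleftrightarrow> boolean_circuit C \<and>
     (\<forall>g\<in>gates C. gate_type C g = NotGate \<longrightarrow> inputs C g \<subseteq> var_gates C)"

definition deterministic :: "'g circuit \<Rightarrow> bool" where
  "deterministic C \<longleftrightarrow>
     (\<forall>g\<in>gates C. gate_type C g = OrGate \<longrightarrow>
        (\<nexists>\<nu> h h'. h \<in> inputs C g \<and> h' \<in> inputs C g \<and> h \<noteq> h' \<and>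
           gate_value C \<nu> h \<and> gate_value C \<nu> h'))"


section \<open>V-trees and structuredness\<close>

text \<open>Binary means at most two children per node: nodes with a single child are allowed.\<close>

datatype 'v vtree = VLeaf 'v | VUnary "'v vtree" | VBinary "'v vtree" "'v vtree"

primrec leaf_list :: "'v vtree \<Rightarrow> 'v list" where
  "leaf_list (VLeaf x) = [x]"
| "leaf_list (VUnary t) = leaf_list t"
| "leaf_list (VBinary l r) = leaf_list l @ leaf_list r"

definition Leaves :: "'v vtree \<Rightarrow> 'v set" where
  "Leaves T = set (leaf_list T)"

definition vtree_over :: "'v vtree \<Rightarrow> 'v set \<Rightarrow> bool" where
  "vtree_over T V \<longleftrightarrow> distinct (leaf_list T) \<and> Leaves T = V"

fun children :: "'v vtree \<Rightarrow> 'v vtree list" where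
  "children (VLeaf x) = []"
| "children (VUnary t) = [t]"
| "children (VBinary l r) = [l, r]"

text \<open>A node of a v-tree is represented by the subtree rooted at it.\<close>

primrec subtrees :: "'v vtree \<Rightarrow> 'v vtree set" where
  "subtrees (VLeaf x) = {VLeaf x}"
| "subtrees (VUnary t) = insert (VUnary t) (subtrees t)"
| "subtrees (VBinary l r) = insert (VBinary l r) (subtrees l \<union> subtrees r)"

text \<open>The list \<open>gs\<close> is an enumeration of the inputs of the gate, in any order.\<close>

definition structures :: "'g vtree \<Rightarrow> 'g circuit \<Rightarrow> bool" where
  "structures T C \<longleftrightarrow> vtree_over T (var_gates C) \<and>
     (\<forall>g\<in>gates C. gate_type C g = AndGate \<and> inputs C g \<noteq> {} \<longrightarrow>
        (\<exists>n\<in>subtrees T. \<exists>gs. distinct gs \<and> set gs = inputs C g \<and>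
           list_all2 (\<lambda>h n'. Vars C h \<subseteq> Leaves n') gs (children n)))"

definition is_SDNNF :: "'g circuit \<Rightarrow> bool" where
  "is_SDNNF C \<longleftrightarrow> is_NNF C \<and> (\<exists>T. structures T C)"

definition is_d_SDNNF :: "'g circuit \<Rightarrow> bool" where
  "is_d_SDNNF C \<longleftrightarrow> is_SDNNF C \<and> deterministic C"

end

theory Submission
  imports Defs Complex_Main
begin

text \<open>
  The leaf sets of the v-tree form a laminar family. Labelling each of its members with the
  clauses that cross one of its two halves yields a tree decomposition, so some leaf set \<open>A\<close> is
  crossed by at least \<open>tw / (2 a)\<close> clauses. A clause is linked to at most \<open>a\<^sup>2 d\<^sup>2\<close> clauses by a
  common clause, so greedily at least \<open>tw / (2 a\<^sup>3 d\<^sup>2)\<close> pairwise unlinked crossing clauses remain.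
  Giving, in each of them, one common value to the variables inside \<open>A\<close> and one to those outside
  turns the formula into set intersection (DNF) or set disjointness (CNF). On the other hand,
  descending from the output of the circuit to a gate whose variables do not lie on both sides of \<open>A\<close>
  covers the accepted valuations by one rectangle per gate, and these rectangles are disjoint
  if the circuit is deterministic. The rank of the intersection matrix and a fooling set for
  disjointness then bound the number of gates.
\<close>

section \<open>Tree decompositions from laminar families\<close>

definition parent_edges :: "'n set \<Rightarrow> 'n \<Rightarrow> ('n \<Rightarrow> 'n) \<Rightarrow> ('n \<times> 'n) set" where
  "parent_edges N r p = {(n, p n) |n. n \<in> N - {r}} \<union> {(p n, n) |n. n \<in> N - {r}}"

text \<open>From each node of \<open>S\<close> the map \<open>p\<close> climbs inside
  \<open>S\<close> until it reaches \<open>t\<close>, by induction on the depth.\<close>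

lemma parent_edges_connected_in:
  fixes depth :: "'n \<Rightarrow> nat"
  assumes depth: "\<And>n. n \<in> N \<Longrightarrow> n \<noteq> r \<Longrightarrow> depth (p n) < depth n"
    and S: "S \<subseteq> N" "t \<in> S" "\<And>n. n \<in> S \<Longrightarrow> n \<noteq> t \<Longrightarrow> n \<noteq> r \<and> p n \<in> S"
  shows "connected_in (parent_edges N r p) S"
proof -
  let ?E = "parent_edges N r p \<inter> S \<times> S"
  have "(n, t) \<in> ?E\<^sup>* \<and> (t, n) \<in> ?E\<^sup>*" if "n \<in> S" for n
    using that
  proof (induction "depth n" arbitrary: n rule: less_induct)
    case less
    show ?case
    proof (cases "n = t")
      case False
      then have n: "n \<noteq> r" "p n \<in> S" "n \<in> N"
        using S less.prems by auto
      then have "(p n, t) \<in> ?E\<^sup>* \<and> (t, p n) \<in> ?E\<^sup>*"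
        using less.hyps depth by blast
      moreover have "(n, p n) \<in> ?E" "(p n, n) \<in> ?E"
        using n less.prems by (auto simp: parent_edges_def)
      ultimately show ?thesis
        by (meson converse_rtrancl_into_rtrancl rtrancl.rtrancl_into_rtrancl)
    qed simp
  qed
  then show ?thesis
    unfolding connected_in_def by (meson rtrancl_trans)
qed

text \<open>In a cycle, both neighbours of a deepest node would be its parent.\<close>

lemma parent_edges_no_cycle:
  fixes depth :: "'n \<Rightarrow> nat"
  assumes depth: "\<And>n. n \<in> N \<Longrightarrow> n \<noteq> r \<Longrightarrow> depth (p n) < depth n"
  shows "\<not> is_cycle (parent_edges N r p) c"
proof
  assume "is_cycle (parent_edges N r p) c"
  then have c: "3 \<le> length c" "distinct c"
    and E: "\<And>i. i < length c \<Longrightarrow> (c ! i, c ! (Suc i mod length c)) \<in> parent_edges N r p"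
    by (auto simp: is_cycle_def)
  let ?l = "length c"
  have up: "m = p n" if "(n, m) \<in> parent_edges N r p \<or> (m, n) \<in> parent_edges N r p"
    "depth m \<le> depth n" for n m
    using that depth by (force simp: parent_edges_def)
  obtain i where i: "i < ?l" "\<And>j. j < ?l \<Longrightarrow> depth (c ! j) \<le> depth (c ! i)"
  proof -
    have "0 \<in> {..<?l}"
      using c by auto
    then have "finite {..<?l}" "{..<?l} \<noteq> {}"
      by blast+
    from Max_in[of "(\<lambda>j. depth (c ! j)) ` {..<?l}"] this
    obtain i where "i < ?l" "depth (c ! i) = Max ((\<lambda>j. depth (c ! j)) ` {..<?l})"
      by fastforce
    then show ?thesis
      using that[of i] by simp
  qed
  \<comment> \<open>\<open>j\<close> and \<open>k\<close> are the cyclic neighbours of the deepest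
    position \<open>i\<close>; they differ because the cycle has length at least 3.\<close>
  define j where "j = (if i = 0 then ?l - 1 else i - 1)"
  define k where "k = (if Suc i = ?l then 0 else Suc i)"
  have jk: "j < ?l" "k < ?l" "j \<noteq> k" "Suc j mod ?l = i" "Suc i mod ?l = k"
    using c i by (auto simp: j_def k_def)
  have "c ! j = p (c ! i)" "c ! k = p (c ! i)"
    using up[of "c ! i" "c ! j"] up[of "c ! i" "c ! k"] E[of i] E[of j] i jk by auto
  then show False
    using c jk nth_eq_iff_index_eq[of c j k] by simp
qed

text \<open>The last assumption stands in for connectivity: the bags that contain \<open>x\<close>
  have a highest node \<open>t\<close>, and climbing from any other such bag keeps
  \<open>x\<close>.\<close>

lemma parent_tree_decomposition:
  fixes depth :: "'n \<Rightarrow> nat"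
  assumes N: "finite N" "r \<in> N" "\<And>n. n \<in> N \<Longrightarrow> n \<noteq> r \<Longrightarrow> p n \<in> N \<and> depth (p n) < depth n"
    and bag: "\<And>n. n \<in> N \<Longrightarrow> bag n \<subseteq> V" "\<And>K. K \<in> F \<Longrightarrow> \<exists>n\<in>N. K \<subseteq> bag n"
    and top: "\<And>x. x \<in> V \<Longrightarrow> \<exists>t\<in>N. x \<in> bag t \<and>
      (\<forall>n\<in>N. x \<in> bag n \<and> n \<noteq> t \<longrightarrow> n \<noteq> r \<and> x \<in> bag (p n))"
  shows "tree_decomposition V F N (parent_edges N r p) bag"
proof -
  have depth: "\<And>n. n \<in> N \<Longrightarrow> n \<noteq> r \<Longrightarrow> depth (p n) < depth n"
    using N by blast
  have "sym (parent_edges N r p)"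
    by (auto simp: parent_edges_def sym_def)
  moreover have "irrefl (parent_edges N r p)"
    using depth by (force simp: parent_edges_def irrefl_def)
  moreover have "parent_edges N r p \<subseteq> N \<times> N"
    using N by (auto simp: parent_edges_def)
  moreover have "connected_in (parent_edges N r p) N"
    using N by (intro parent_edges_connected_in[where depth = depth and t = r]) auto
  moreover have "connected_in (parent_edges N r p) {t \<in> N. x \<in> bag t}" if x: "x \<in> V" for x
  proof -
    from top[OF x] obtain t where "t \<in> N" "x \<in> bag t"
      "\<forall>n\<in>N. x \<in> bag n \<and> n \<noteq> t \<longrightarrow> n \<noteq> r \<and> x \<in> bag (p n)"
      by blast
    then show ?thesis
      using N by (intro parent_edges_connected_in[where depth = depth and t = t]) auto
  qed
  ultimately show ?thesis
    using N bag parent_edges_no_cycle[of N r depth p] depth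
    by (auto simp: tree_decomposition_def is_tree_def)
qed

text \<open>Since \<open>treewidth\<close> ranges over trees on natural numbers, the tree is
  transported along an injection \<open>f\<close> with inverse \<open>g\<close>.
  \<open>Suc w\<close> makes up for the one subtracted in \<open>width\<close>.\<close>

lemma treewidth_le_parent_tree:
  fixes depth :: "'n \<Rightarrow> nat"
  assumes N: "finite N" "r \<in> N" "\<And>n. n \<in> N \<Longrightarrow> n \<noteq> r \<Longrightarrow> p n \<in> N \<and> depth (p n) < depth n"
    and bag: "\<And>n. n \<in> N \<Longrightarrow> bag n \<subseteq> V" "\<And>K. K \<in> F \<Longrightarrow> \<exists>n\<in>N. K \<subseteq> bag n"
    and top: "\<And>x. x \<in> V \<Longrightarrow> \<exists>t\<in>N. x \<in> bag t \<and>
      (\<forall>n\<in>N. x \<in> bag n \<and> n \<noteq> t \<longrightarrow> n \<noteq> r \<and> x \<in> bag (p n))"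
    and card: "\<And>n. n \<in> N \<Longrightarrow> card (bag n) \<le> Suc w"
  shows "treewidth V F \<le> w"
proof -
  obtain f :: "'n \<Rightarrow> nat" where f: "inj_on f N"
    using finite_imp_inj_to_nat_seg[OF N(1)] by blast
  define g where "g = inv_into N f"
  have g [simp]: "g (f n) = n" if "n \<in> N" for n
    using f that by (simp add: g_def)
  have f_eq [simp]: "f n = f m \<longleftrightarrow> n = m" if "n \<in> N" "m \<in> N" for n m
    using f that by (auto simp: inj_on_def)
  let ?E = "parent_edges (f ` N) (f r) (f \<circ> p \<circ> g)"
  have "tree_decomposition V F (f ` N) ?E (bag \<circ> g)"
  proof (rule parent_tree_decomposition[where depth = "depth \<circ> g"])
    fix x assume "x \<in> V"
    from top[OF this] obtain t where "t \<in> N" "x \<in> bag t"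
      "\<forall>n\<in>N. x \<in> bag n \<and> n \<noteq> t \<longrightarrow> n \<noteq> r \<and> x \<in> bag (p n)"
      by blast
    then show "\<exists>t\<in>f ` N. x \<in> (bag \<circ> g) t \<and> (\<forall>n\<in>f ` N. x \<in> (bag \<circ> g) n \<and> n \<noteq> t \<longrightarrow>
        n \<noteq> f r \<and> x \<in> (bag \<circ> g) ((f \<circ> p \<circ> g) n))"
      using N by (intro bexI[of _ "f t"]) auto
  next
    show "(bag \<circ> g) n \<subseteq> V" if "n \<in> f ` N" for n
      using that bag(1) by force
    show "\<exists>n\<in>f ` N. K \<subseteq> (bag \<circ> g) n" if "K \<in> F" for K
      using bag(2)[OF that] by force
  qed (use N in auto)
  then have "treewidth V F \<le> width (f ` N) (bag \<circ> g)"
    unfolding treewidth_def by (intro Least_le) blast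
  also have "\<dots> \<le> w"
  proof -
    have "Max ((\<lambda>t. card ((bag \<circ> g) t)) ` f ` N) \<le> Suc w"
      using N card by (subst Max_le_iff) auto
    then show ?thesis
      by (simp add: width_def)
  qed
  finally show ?thesis .
qed

section \<open>Binary laminar families and crossing hyperedges\<close>

definition crossing :: "'v set set \<Rightarrow> 'v set \<Rightarrow> 'v set set" where
  "crossing F A = {K \<in> F. K \<inter> A \<noteq> {} \<and> \<not> K \<subseteq> A}"

lemma card_UN_le_mult:
  assumes "finite I" "card I \<le> m" "\<And>i. i \<in> I \<Longrightarrow> card (B i) \<le> k"
  shows "card (\<Union>i\<in>I. B i) \<le> m * k"
proof -
  have "card (\<Union>i\<in>I. B i) \<le> (\<Sum>i\<in>I. card (B i))"
    by (rule card_UN_le[OF assms(1)])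
  also have "\<dots> \<le> card I * k"
    using sum_bounded_above[of I "\<lambda>i. card (B i)" k] assms by simp
  also have "\<dots> \<le> m * k"
    using assms(2) by simp
  finally show ?thesis .
qed

text \<open>Using leaf sets in place of v-tree nodes identifies a unary node with its child, so each
  member that is not a singleton splits into two strictly smaller members.\<close>

locale binary_laminar =
  fixes V :: "'v set" and L :: "'v set set"
  assumes fin: "finite V"
    and sub: "A \<in> L \<Longrightarrow> A \<subseteq> V"
    and nonempty: "A \<in> L \<Longrightarrow> A \<noteq> {}"
    and top: "V \<in> L"
    and single: "x \<in> V \<Longrightarrow> {x} \<in> L"
    and laminar: "A \<in> L \<Longrightarrow> B \<in> L \<Longrightarrow> A \<subseteq> B \<or> B \<subseteq> A \<or> A \<inter> B = {}"
    and split: "A \<in> L \<Longrightarrow> (\<exists>x. A = {x}) \<or> (\<exists>B\<in>L. \<exists>C\<in>L. A = B \<union> C \<and> B \<subset> A \<and> C \<subset> A)"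
begin

lemma finite_family: "finite L"
  by (rule finite_subset[of _ "Pow V"]) (use fin sub in auto)

lemma parent_exists:
  assumes A: "A \<in> L" "A \<noteq> V"
  shows "\<exists>P\<in>L. A \<subset> P \<and> (\<forall>B\<in>L. A \<subset> B \<longrightarrow> P \<subseteq> B)"
proof -
  let ?S = "{B \<in> L. A \<subset> B}"
  have "V \<in> ?S"
    using A sub top by auto
  then obtain P where P: "P \<in> ?S" "\<And>B. B \<in> ?S \<Longrightarrow> card P \<le> card B"
    using ex_has_least_nat[of "\<lambda>B. B \<in> ?S" V card] by blast
  have "P \<subseteq> B" if B: "B \<in> L" "A \<subset> B" for B
  proof -
    \<comment> \<open>Both sets contain the non-empty set \<open>A\<close>, so laminarity makes them
      comparable: the members above \<open>A\<close> form a chain.\<close>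
    have "P \<inter> B \<noteq> {}"
      using P B nonempty[OF A(1)] by auto
    then consider "P \<subseteq> B" | "B \<subseteq> P"
      using laminar[of P B] P B by blast
    then show ?thesis
    proof cases
      case 2
      then show ?thesis
        using P(2)[of B] P(1) B sub[of P] fin
        by (metis (mono_tags, lifting) card_seteq finite_subset mem_Collect_eq order_refl)
    qed
  qed
  then show ?thesis
    using P by blast
qed

definition parent :: "'v set \<Rightarrow> 'v set" where
  "parent A = (SOME P. P \<in> L \<and> A \<subset> P \<and> (\<forall>B\<in>L. A \<subset> B \<longrightarrow> P \<subseteq> B))"

lemma parent:
  assumes "A \<in> L" "A \<noteq> V"
  shows "parent A \<in> L" "A \<subset> parent A" "\<And>B. B \<in> L \<Longrightarrow> A \<subset> B \<Longrightarrow> parent A \<subseteq> B"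
proof -
  have "\<exists>P. P \<in> L \<and> A \<subset> P \<and> (\<forall>B\<in>L. A \<subset> B \<longrightarrow> P \<subseteq> B)"
    using parent_exists[OF assms] by blast
  from someI_ex[OF this, folded parent_def]
  show "parent A \<in> L" "A \<subset> parent A" "\<And>B. B \<in> L \<Longrightarrow> A \<subset> B \<Longrightarrow> parent A \<subseteq> B"
    by blast+
qed

text \<open>
  With \<open>L\<close> seen as a tree, \<open>spans K\<close> holds on the smallest subtree that contains the leaves of \<open>K\<close>.
\<close>

definition spans :: "'v set \<Rightarrow> 'v set \<Rightarrow> bool" where
  "spans K A \<longleftrightarrow> K \<inter> A \<noteq> {} \<and> (\<forall>B\<in>L. B \<subset> A \<longrightarrow> \<not> K \<subseteq> B)"

text \<open>The singletons put every vertex into some bag, also a vertex that lies in no clause, so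
  that each vertex has a highest bag.\<close>

definition laminar_bag :: "'v set set \<Rightarrow> 'v set \<Rightarrow> 'v set" where
  "laminar_bag F A = \<Union>{K \<in> F \<union> (\<lambda>x. {x}) ` V. spans K A}"

text \<open>A member strictly below the parent that contains \<open>K\<close> meets
  \<open>A\<close>, hence is comparable with it. If it lies strictly above \<open>A\<close>, it
  contradicts the minimality of the parent; otherwise \<open>K\<close> would be contained in
  \<open>A\<close>.\<close>

lemma spans_parent:
  assumes "A \<in> L" "A \<noteq> V" "spans K A" "\<not> K \<subseteq> A"
  shows "spans K (parent A)"
  unfolding spans_def
proof (intro conjI ballI impI notI)
  note p = parent[OF assms(1,2)]
  show "K \<inter> parent A = {} \<Longrightarrow> False"
    using p assms(3) by (auto simp: spans_def)
  fix B assume B: "B \<in> L" "B \<subset> parent A" "K \<subseteq> B"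
  have "B \<inter> A \<noteq> {}"
    using B assms(3) by (auto simp: spans_def)
  then consider "A \<subset> B" | "A = B" | "B \<subset> A"
    using laminar[OF B(1) assms(1)] by blast
  then show False
    using p(3)[OF B(1)] B assms by cases (auto simp: spans_def)
qed

lemma spans_top_exists:
  assumes "K \<subseteq> V" "K \<noteq> {}"
  shows "\<exists>M\<in>L. K \<subseteq> M \<and> spans K M"
proof -
  let ?P = "\<lambda>B. B \<in> L \<and> K \<subseteq> B"
  obtain M where M: "?P M" "\<And>B. ?P B \<Longrightarrow> card M \<le> card B"
    using ex_has_least_nat[of ?P V card] assms top by blast
  have "card B < card M" if "B \<subset> M" for B
    using that M sub fin by (meson finite_subset psubset_card_mono)
  then have "\<not> K \<subseteq> B" if "B \<in> L" "B \<subset> M" for B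
    using M(2)[of B] that by (meson not_le)
  then have "spans K M"
    using M(1) assms by (auto simp: spans_def)
  then show ?thesis
    using M by blast
qed

text \<open>Each set \<open>K\<close> through \<open>x\<close> has a least member containing it, its
  peak; the highest bag of \<open>x\<close> is at the largest such peak.\<close>

lemma laminar_bag_top:
  assumes F: "F \<subseteq> Pow V" and x: "x \<in> V"
  shows "\<exists>t\<in>L. x \<in> laminar_bag F t \<and>
    (\<forall>A\<in>L. x \<in> laminar_bag F A \<and> A \<noteq> t \<longrightarrow> A \<noteq> V \<and> x \<in> laminar_bag F (parent A))"
proof -
  let ?F = "F \<union> (\<lambda>x. {x}) ` V"
  have F': "?F \<subseteq> Pow V"
    using F by auto
  \<comment> \<open>\<open>K \<subseteq> M\<close> together with \<open>spans K M\<close> says that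
    \<open>M\<close> is the peak of \<open>K\<close>.\<close>
  let ?P = "\<lambda>M. M \<in> L \<and> (\<exists>K\<in>?F. x \<in> K \<and> K \<subseteq> M \<and> spans K M)"
  obtain M0 where "?P M0"
    using spans_top_exists[of "{x}"] x by blast
  moreover have "\<forall>M. ?P M \<longrightarrow> card M < Suc (card V)"
    using sub fin by (auto intro: card_mono simp: less_Suc_eq_le)
  ultimately have "\<exists>M. ?P M \<and> (\<forall>B. ?P B \<longrightarrow> card B \<le> card M)"
    by (rule ex_has_greatest_nat)
  then obtain M where M: "?P M" "\<And>B. ?P B \<Longrightarrow> card B \<le> card M"
    by metis
  then obtain K' where K': "K' \<in> ?F" "x \<in> K'" "K' \<subseteq> M" "spans K' M"
    by blast
  have le: "B \<subseteq> M" if B: "B \<in> L" "K \<in> ?F" "x \<in> K" "K \<subseteq> B" "spans K B" for B K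
  proof -
    have "x \<in> B" "x \<in> M"
      using B M(1) by auto
    then have "B \<subseteq> M \<or> M \<subset> B"
      using laminar[of B M] B(1) M(1) by blast
    then show ?thesis
    proof
      assume "M \<subset> B"
      moreover have "finite B"
        using B(1) sub[of B] finite_subset[OF _ fin] by blast
      moreover have "card B \<le> card M"
        using M(2)[of B] B by blast
      ultimately show ?thesis
        using psubset_card_mono[of B M] by simp
    qed
  qed
  have step: "A \<noteq> V \<and> x \<in> laminar_bag F (parent A)"
    if A: "A \<in> L" "x \<in> laminar_bag F A" "A \<noteq> M" for A
  proof -
    from A obtain K where K: "K \<in> ?F" "x \<in> K" "spans K A"
      by (auto simp: laminar_bag_def)
    show ?thesis
    proof (cases "K \<subseteq> A")
      case False
      then have "A \<noteq> V"
        using K F' by auto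
      then show ?thesis
        using spans_parent[OF A(1) _ K(3) False] K by (auto simp: laminar_bag_def)
    next
      \<comment> \<open>Here \<open>A\<close> is the peak of \<open>K\<close>, so \<open>K\<close>
        does not continue upwards. The set \<open>K'\<close>, whose peak is \<open>M\<close>, also
        contains \<open>x\<close> and spans every member of the family between \<open>A\<close> and
        \<open>M\<close>, in particular the parent.\<close>
      case True
      then have "A \<subset> M"
        using le[OF A(1) K(1,2) True K(3)] A(3) by blast
      moreover have "M \<subseteq> V"
        using M sub by blast
      ultimately have "A \<noteq> V"
        by blast
      note p = parent[OF A(1) this]
      have "parent A \<subseteq> M"
        using p(3) M \<open>A \<subset> M\<close> by blast
      moreover have "x \<in> parent A"
        using p(2) True K(2) by blast
      ultimately have "spans K' (parent A)"
        using K'(2,4) by (auto simp: spans_def)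
      then show ?thesis
        using K' \<open>A \<noteq> V\<close> by (auto simp: laminar_bag_def)
    qed
  qed
  have "x \<in> laminar_bag F M"
    using K' by (auto simp: laminar_bag_def)
  moreover have "M \<in> L"
    using M(1) by blast
  ultimately show ?thesis
    using step by (intro bexI[of _ M] conjI ballI impI) auto
qed

text \<open>A set that spans \<open>A = B \<union> C\<close> meets one half and is contained in
  neither, so it is a clause that crosses that half. The alternative 1 is for a leaf that no clause
  crosses, whose bag has at most that one vertex.\<close>

lemma card_laminar_bag_le:
  assumes F: "F \<subseteq> Pow V" and a: "\<And>K. K \<in> F \<Longrightarrow> card K \<le> a"
    and s: "\<And>A. A \<in> L \<Longrightarrow> card (crossing F A) \<le> s"
    and A: "A \<in> L"
  shows "card (laminar_bag F A) \<le> max 1 (2 * a * s)"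
proof -
  have finF: "finite F"
    using F fin by (intro finite_subset[of F "Pow V"]) auto
  have fin_cross: "finite (crossing F B)" for B
    using finF by (simp add: crossing_def)
  have fin_Un: "finite (\<Union>(crossing F B))" for B
    using F fin by (intro finite_subset[of "\<Union>(crossing F B)" V]) (auto simp: crossing_def)
  have cross: "card (\<Union>(crossing F B)) \<le> a * s" if "B \<in> L" for B
    using card_UN_le_mult[OF fin_cross s[OF that], of id a] a
    by (simp add: crossing_def mult.commute)
  from split[OF A] show ?thesis
  proof
    assume "\<exists>x. A = {x}"
    then obtain x where x: "A = {x}" ..
    have sub: "laminar_bag F A \<subseteq> insert x (\<Union>(crossing F A))"
      by (auto simp: laminar_bag_def crossing_def spans_def x)
    show ?thesis
    proof (cases "crossing F A = {}")
      case True
      then show ?thesis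
        using card_mono[OF _ sub] by simp
    next
      case False
      then have "laminar_bag F A \<subseteq> \<Union>(crossing F A)"
        using sub by (auto simp: crossing_def x)
      then have "card (laminar_bag F A) \<le> a * s"
        using card_mono[OF fin_Un] cross[OF A] by (meson order_trans)
      then show ?thesis
        by simp
    qed
  next
    assume "\<exists>B\<in>L. \<exists>C\<in>L. A = B \<union> C \<and> B \<subset> A \<and> C \<subset> A"
    then obtain B C where BC: "B \<in> L" "C \<in> L" "A = B \<union> C" "B \<subset> A" "C \<subset> A"
      by blast
    have "laminar_bag F A \<subseteq> \<Union>(crossing F B) \<union> \<Union>(crossing F C)"
    proof
      fix x assume "x \<in> laminar_bag F A"
      then obtain K where K: "K \<in> F \<union> (\<lambda>x. {x}) ` V" "x \<in> K" "spans K A"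
        by (auto simp: laminar_bag_def)
      then have *: "\<not> K \<subseteq> B" "\<not> K \<subseteq> C" "K \<inter> B \<noteq> {} \<or> K \<inter> C \<noteq> {}"
        using BC by (auto simp: spans_def)
      then have "K \<in> F"
        using K by auto
      then show "x \<in> \<Union>(crossing F B) \<union> \<Union>(crossing F C)"
        using * K by (auto simp: crossing_def)
    qed
    then have "card (laminar_bag F A) \<le> card (\<Union>(crossing F B) \<union> \<Union>(crossing F C))"
      using fin_Un by (intro card_mono) auto
    also have "\<dots> \<le> card (\<Union>(crossing F B)) + card (\<Union>(crossing F C))"
      by (rule card_Un_le)
    also have "\<dots> \<le> 2 * a * s"
      using cross[OF BC(1)] cross[OF BC(2)] by simp
    finally show ?thesis
      by simp
  qed
qed

text \<open>The depth of a member is the number of vertices outside it. With truncated subtraction,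
  \<open>Suc (2 * a * s - 1)\<close> is exactly \<open>max 1 (2 * a * s)\<close>.\<close>

lemma treewidth_le_crossing:
  assumes F: "F \<subseteq> Pow V" "{} \<notin> F" and a: "\<And>K. K \<in> F \<Longrightarrow> card K \<le> a"
    and s: "\<And>A. A \<in> L \<Longrightarrow> card (crossing F A) \<le> s"
  shows "treewidth V F \<le> 2 * a * s - 1"
proof (rule treewidth_le_parent_tree[where p = parent and r = V and N = L
        and depth = "\<lambda>A. card (V - A)" and bag = "laminar_bag F"])
  show "finite L"
    by (rule finite_family)
  show "V \<in> L"
    by (rule top)
  show "parent A \<in> L \<and> card (V - parent A) < card (V - A)" if "A \<in> L" "A \<noteq> V" for A
  proof -
    note p = parent[OF that]
    then have "V - parent A \<subset> V - A"
      using sub[OF p(1)] by auto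
    then show ?thesis
      using p fin by (simp add: psubset_card_mono)
  qed
  show "laminar_bag F A \<subseteq> V" if "A \<in> L" for A
    using F by (auto simp: laminar_bag_def)
  show "\<exists>A\<in>L. K \<subseteq> laminar_bag F A" if K: "K \<in> F" for K
  proof -
    have "K \<subseteq> V" "K \<noteq> {}"
      using K F by auto
    from spans_top_exists[OF this] show ?thesis
      using K by (auto simp: laminar_bag_def)
  qed
  show "\<exists>t\<in>L. x \<in> laminar_bag F t \<and>
    (\<forall>A\<in>L. x \<in> laminar_bag F A \<and> A \<noteq> t \<longrightarrow> A \<noteq> V \<and> x \<in> laminar_bag F (parent A))"
    if "x \<in> V" for x
    using laminar_bag_top[OF F(1) that] .
  show "card (laminar_bag F A) \<le> Suc (2 * a * s - 1)" if "A \<in> L" for A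
    using card_laminar_bag_le[OF F(1) a s that] by simp
qed

end


section \<open>The leaf sets of a v-tree\<close>

lemma Leaves_simps [simp]:
  "Leaves (VLeaf x) = {x}"
  "Leaves (VUnary t) = Leaves t"
  "Leaves (VBinary l r) = Leaves l \<union> Leaves r"
  by (simp_all add: Leaves_def)

lemma finite_Leaves [simp]: "finite (Leaves T)"
  by (simp add: Leaves_def)

lemma Leaves_nonempty: "Leaves T \<noteq> {}"
  by (induction T) auto

lemma subtree_self [simp]: "T \<in> subtrees T"
  by (cases T) auto

lemma subtree_Leaves_subset: "n \<in> subtrees T \<Longrightarrow> Leaves n \<subseteq> Leaves T"
  by (induction T) auto

lemma child_subtree: "n \<in> subtrees T \<Longrightarrow> m \<in> set (children n) \<Longrightarrow> m \<in> subtrees T"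
  by (induction T) auto

lemma subtree_distinct: "n \<in> subtrees T \<Longrightarrow> distinct (leaf_list T) \<Longrightarrow> distinct (leaf_list n)"
  by (induction T) auto

lemma leaf_subtree: "x \<in> Leaves T \<Longrightarrow> VLeaf x \<in> subtrees T"
  by (induction T) auto

lemma subtrees_laminar:
  assumes "distinct (leaf_list T)" "n \<in> subtrees T" "m \<in> subtrees T"
  shows "Leaves n \<subseteq> Leaves m \<or> Leaves m \<subseteq> Leaves n \<or> Leaves n \<inter> Leaves m = {}"
  using assms
proof (induction T)
  case (VUnary T)
  then show ?case
    using subtree_Leaves_subset[of n T] subtree_Leaves_subset[of m T] by auto
next
  case (VBinary l r)
  have lr: "Leaves l \<inter> Leaves r = {}"
    using VBinary.prems by (auto simp: Leaves_def)
  have dist: "distinct (leaf_list l)" "distinct (leaf_list r)"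
    using VBinary.prems by auto
  consider "n = VBinary l r \<or> m = VBinary l r" | "n \<in> subtrees l" "m \<in> subtrees l"
    | "n \<in> subtrees r" "m \<in> subtrees r" | "n \<in> subtrees l" "m \<in> subtrees r"
    | "n \<in> subtrees r" "m \<in> subtrees l"
    using VBinary.prems by auto
  then show ?case
  proof cases
    case 1
    then show ?thesis
      using VBinary.prems(2,3) subtree_Leaves_subset by metis
  next
    case 4
    then show ?thesis
      using subtree_Leaves_subset[of n l] subtree_Leaves_subset[of m r] lr by blast
  next
    case 5
    then show ?thesis
      using subtree_Leaves_subset[of n r] subtree_Leaves_subset[of m l] lr by blast
  qed (use VBinary.IH dist in simp_all)
qed simp

text \<open>A unary node has the leaf set of its child, so the two halves are found at the first
  binary node below it.\<close>

lemma subtree_split: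
  assumes "distinct (leaf_list n)"
  shows "(\<exists>x. Leaves n = {x}) \<or> (\<exists>l\<in>subtrees n. \<exists>r\<in>subtrees n.
    Leaves n = Leaves l \<union> Leaves r \<and> Leaves l \<subset> Leaves n \<and> Leaves r \<subset> Leaves n)"
  using assms
proof (induction n)
  case (VBinary l r)
  have "Leaves l \<inter> Leaves r = {}"
    using VBinary.prems by (auto simp: Leaves_def)
  then show ?case
    using Leaves_nonempty[of l] Leaves_nonempty[of r]
    by (intro disjI2 bexI[of _ l] bexI[of _ r]) auto
qed auto

lemma subtree_trans: "n \<in> subtrees m \<Longrightarrow> m \<in> subtrees T \<Longrightarrow> n \<in> subtrees T"
  by (induction T) auto

lemma vtree_binary_laminar:
  assumes "vtree_over T V"
  shows "binary_laminar V (Leaves ` subtrees T)"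
proof
  have T: "distinct (leaf_list T)" "Leaves T = V"
    using assms by (auto simp: vtree_over_def)
  show "finite V"
    using T by auto
  show "A \<subseteq> V" "A \<noteq> {}" if "A \<in> Leaves ` subtrees T" for A
    using that subtree_Leaves_subset T Leaves_nonempty by auto
  show "V \<in> Leaves ` subtrees T"
    using T by (auto intro: image_eqI[of _ _ T])
  show "{x} \<in> Leaves ` subtrees T" if "x \<in> V" for x
    using leaf_subtree[of x T] that T by (auto intro: image_eqI[of _ _ "VLeaf x"])
  show "A \<subseteq> B \<or> B \<subseteq> A \<or> A \<inter> B = {}"
    if "A \<in> Leaves ` subtrees T" "B \<in> Leaves ` subtrees T" for A B
    using that subtrees_laminar[OF T(1)] by blast
  show "(\<exists>x. A = {x}) \<or>
      (\<exists>B\<in>Leaves ` subtrees T. \<exists>C\<in>Leaves ` subtrees T. A = B \<union> C \<and> B \<subset> A \<and> C \<subset> A)"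
    if A: "A \<in> Leaves ` subtrees T" for A
  proof -
    obtain n where n: "A = Leaves n" "n \<in> subtrees T"
      using A by blast
    from subtree_split[OF subtree_distinct[OF n(2) T(1)]] show ?thesis
      unfolding n(1) using subtree_trans[OF _ n(2)] by blast
  qed
qed


section \<open>Two bounds on rectangle covers\<close>

text \<open>Gaussian elimination: there are more unknowns (\<open>I\<close>) than equations
  (\<open>J\<close>), and each equation removes at most one unknown.\<close>

lemma homogeneous_system_nontrivial_solution:
  fixes v :: "'j \<Rightarrow> 'i \<Rightarrow> 'a::field"
  assumes "finite J" "finite I" "card J < card I"
  shows "\<exists>c. (\<exists>i\<in>I. c i \<noteq> 0) \<and> (\<forall>j\<in>J. (\<Sum>i\<in>I. c i * v j i) = 0)"
  using assms
proof (induction J arbitrary: I v rule: finite_induct)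
  case empty
  then have "I \<noteq> {}"
    by auto
  then show ?case
    by (intro exI[of _ "\<lambda>_. 1"]) auto
next
  case (insert j J)
  show ?case
  proof (cases "\<forall>i\<in>I. v j i = 0")
    case True
    have "card J < card I"
      using insert by simp
    from insert.IH[OF insert.prems(1) this, of v] show ?thesis
      using True by auto
  next
    case False
    then obtain k where k: "k \<in> I" "v j k \<noteq> 0"
      by blast
    \<comment> \<open>Equation \<open>j\<close> is used to eliminate the unknown \<open>k\<close>
      from the other equations.\<close>
    define w where "w = (\<lambda>j' i. v j' i - v j' k * v j i / v j k)"
    have "card J < card (I - {k})"
      using insert k by simp
    from insert.IH[OF _ this, of w] insert.prems obtain c where
      c: "\<exists>i\<in>I - {k}. c i \<noteq> 0" "\<And>j'. j' \<in> J \<Longrightarrow> (\<Sum>i\<in>I - {k}. c i * w j' i) = 0"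
      by auto
    \<comment> \<open>Back substitution: the value at \<open>k\<close> is the one that satisfies
      equation \<open>j\<close>.\<close>
    define c' where "c' = c(k := - (\<Sum>i\<in>I - {k}. c i * v j i) / v j k)"
    have sum: "(\<Sum>i\<in>I. c' i * v j' i) = c' k * v j' k + (\<Sum>i\<in>I - {k}. c i * v j' i)" for j'
    proof -
      have "(\<Sum>i\<in>I - {k}. c' i * v j' i) = (\<Sum>i\<in>I - {k}. c i * v j' i)"
        by (rule sum.cong) (auto simp: c'_def)
      then show ?thesis
        using insert.prems k by (subst sum.remove[of I k]) auto
    qed
    have "(\<Sum>i\<in>I. c' i * v j' i) = 0" if "j' \<in> insert j J" for j'
    proof (cases "j' = j")
      case True
      have "c' k * v j k = - (\<Sum>i\<in>I - {k}. c i * v j i)"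
        using k by (simp add: c'_def)
      then show ?thesis
        by (simp add: True sum)
    next
      case False
      define q where "q = v j' k / v j k"
      from False have "0 = (\<Sum>i\<in>I - {k}. c i * w j' i)"
        using c(2)[of j'] that by simp
      also have "\<dots> = (\<Sum>i\<in>I - {k}. c i * v j' i - c i * v j i * q)"
        by (intro sum.cong refl) (simp add: w_def q_def right_diff_distrib mult_ac)
      also have "\<dots> = (\<Sum>i\<in>I. c' i * v j' i)"
      proof -
        have "c' k * v j' k = - (\<Sum>i\<in>I - {k}. c i * v j i) * q"
          by (simp add: c'_def q_def)
        then show ?thesis
          by (simp add: sum[of j'] sum_subtractf flip: sum_distrib_right)
      qed
      finally show ?thesis
        by simp
    qed
    moreover have "\<exists>i\<in>I. c' i \<noteq> 0"
      using c(1) by (auto simp: c'_def)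
    ultimately show ?thesis
      by blast
  qed
qed

text \<open>By induction on the cardinality, the coefficients of all smaller non-empty subsets of
  \<open>R\<close> vanish, which leaves only \<open>c R\<close> in the sum for
  \<open>R\<close>.\<close>

lemma subset_sums_zero:
  fixes c :: "'b set \<Rightarrow> 'a::ab_group_add"
  assumes "finite X" and zero: "\<And>S. S \<subseteq> X \<Longrightarrow> (\<Sum>R\<in>Pow S - {{}}. c R) = 0"
    and "R \<subseteq> X" "R \<noteq> {}"
  shows "c R = 0"
  using assms(3,4)
proof (induction "card R" arbitrary: R rule: less_induct)
  case less
  have fin: "finite R"
    using less.prems assms(1) by (auto intro: finite_subset)
  have "(\<Sum>S\<in>(Pow R - {{}}) - {R}. c S) = 0"
  proof (rule sum.neutral, rule ballI)
    fix S assume "S \<in> (Pow R - {{}}) - {R}"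
    then have "S \<subset> R" "S \<noteq> {}"
      by auto
    then show "c S = 0"
      using less fin by (meson order_trans psubset_card_mono psubset_imp_subset)
  qed
  moreover have "(\<Sum>S\<in>Pow R - {{}}. c S) = c R + (\<Sum>S\<in>(Pow R - {{}}) - {R}. c S)"
    using less.prems fin by (intro sum.remove) auto
  ultimately show ?case
    using zero[OF less.prems(1)] by simp
qed

text \<open>
  The intersection matrix of the non-empty subsets of \<open>X\<close> has full rank: its columns determine
  all the sums over subsets, hence by Moebius inversion the coefficients.
\<close>

lemma disjoint_rectangle_cover_intersects:
  fixes P :: "'g \<Rightarrow> 'b set \<Rightarrow> 'b set \<Rightarrow> bool"
  assumes fin: "finite X" "finite G"
    and cover: "\<And>S R. S \<subseteq> X \<Longrightarrow> R \<subseteq> X \<Longrightarrow> S \<inter> R \<noteq> {} \<longleftrightarrow> (\<exists>g\<in>G. P g S R)"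
    and disjoint: "\<And>g g' S R. g \<in> G \<Longrightarrow> g' \<in> G \<Longrightarrow> P g S R \<Longrightarrow> P g' S R \<Longrightarrow> g = g'"
    and rectangle: "\<And>g S R S' R'. g \<in> G \<Longrightarrow> P g S R \<Longrightarrow> P g S' R' \<Longrightarrow> P g S R'"
  shows "2 ^ card X - 1 \<le> card G"
proof (rule ccontr)
  let ?I = "Pow X - {{}}"
  assume "\<not> ?thesis"
  moreover have "card ?I = 2 ^ card X - 1"
    using fin by (simp add: card_Pow card_Diff_singleton)
  ultimately have "card G < card ?I"
    by simp
  \<comment> \<open>\<open>v g\<close> is the indicator of the columns of rectangle
    \<open>g\<close>. With too few rectangles, some non-zero \<open>c\<close> is orthogonal to all
    of these.\<close>
  define v :: "'g \<Rightarrow> 'b set \<Rightarrow> rat" where "v = (\<lambda>g R. of_bool (\<exists>S. P g S R))"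
  obtain c where c: "\<exists>R\<in>?I. c R \<noteq> 0" "\<And>g. g \<in> G \<Longrightarrow> (\<Sum>R\<in>?I. c R * v g R) = 0"
    using homogeneous_system_nontrivial_solution[OF fin(2) _ \<open>card G < card ?I\<close>, of v] fin
    by auto
  have zero: "(\<Sum>R\<in>?I. c R * of_bool (S \<inter> R \<noteq> {})) = 0" if S: "S \<subseteq> X" for S
  proof -
    \<comment> \<open>Row \<open>S\<close> of the intersection matrix is the sum of the column
      indicators of the rectangles that meet this row: by disjointness exactly one of them covers an
      intersecting pair, and by the rectangle property none of them has a column disjoint from
      \<open>S\<close>.\<close>
    have decomp: "of_bool (S \<inter> R \<noteq> {}) = (\<Sum>g\<in>{g \<in> G. \<exists>R'. P g S R'}. v g R)" if "R \<in> ?I" for R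
    proof (cases "S \<inter> R = {}")
      case True
      have "v g R = 0" if "g \<in> G" "P g S R'" for g R'
        using rectangle[OF that] cover[OF S, of R] that(1) True \<open>R \<in> ?I\<close> by (auto simp: v_def)
      then have "(\<Sum>g\<in>{g \<in> G. \<exists>R'. P g S R'}. v g R) = 0"
        by (intro sum.neutral) blast
      then show ?thesis
        using True by simp
    next
      case False
      then obtain g where g: "g \<in> G" "P g S R"
        using cover[OF S, of R] \<open>R \<in> ?I\<close> by auto
      have v: "v g' R = of_bool (g' = g)" if "g' \<in> G" "P g' S R'" for g' R'
      proof -
        have "g' = g" if "P g' S' R" for S'
          using rectangle[OF \<open>g' \<in> G\<close> \<open>P g' S R'\<close> that] disjoint[OF \<open>g' \<in> G\<close> g(1) _ g(2)] by blast
        then show ?thesis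
          using g(2) unfolding v_def by (intro arg_cong[of _ _ of_bool]) blast
      qed
      have "(\<Sum>g'\<in>{g \<in> G. \<exists>R'. P g S R'}. v g' R)
          = (\<Sum>g'\<in>{g \<in> G. \<exists>R'. P g S R'}. if g' = g then 1 else 0)"
      proof (rule sum.cong)
        fix g' assume "g' \<in> {g \<in> G. \<exists>R'. P g S R'}"
        then show "v g' R = (if g' = g then 1 else 0)"
          using v by fastforce
      qed simp
      also have "\<dots> = 1"
        using g fin by (subst sum.delta) auto
      finally show ?thesis
        using False by simp
    qed
    have "(\<Sum>R\<in>?I. c R * of_bool (S \<inter> R \<noteq> {}))
        = (\<Sum>R\<in>?I. \<Sum>g\<in>{g \<in> G. \<exists>R'. P g S R'}. c R * v g R)"
      by (rule sum.cong) (simp_all add: decomp sum_distrib_left del: of_bool_eq_0_iff)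
    also have "\<dots> = (\<Sum>g\<in>{g \<in> G. \<exists>R'. P g S R'}. \<Sum>R\<in>?I. c R * v g R)"
      by (rule sum.swap)
    also have "\<dots> = 0"
      using c by (intro sum.neutral) auto
    finally show ?thesis .
  qed
  have "(\<Sum>R\<in>Pow S - {{}}. c R) = 0" if S: "S \<subseteq> X" for S
  proof -
    have "(\<Sum>R\<in>Pow S - {{}}. c R) = (\<Sum>R\<in>?I. c R * of_bool (R \<subseteq> S))"
      using S fin by (intro sum.mono_neutral_cong_left) auto
    \<comment> \<open>A non-empty \<open>R \<subseteq> X\<close> always meets \<open>X\<close>, and
      it is contained in \<open>S\<close> iff it misses \<open>X - S\<close>.\<close>
    also have "\<dots> = (\<Sum>R\<in>?I. c R * of_bool (X \<inter> R \<noteq> {}) - c R * of_bool ((X - S) \<inter> R \<noteq> {}))"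
      by (rule sum.cong) auto
    also have "\<dots> = 0"
      using zero[of X] zero[of "X - S"] by (simp add: sum_subtractf)
    finally show ?thesis .
  qed
  then show False
    using subset_sums_zero[OF fin(1), of c] c(1) by blast
qed

text \<open>The pairs of complementary subsets form a fooling set.\<close>

lemma rectangle_cover_disjoint_sets:
  fixes P :: "'g \<Rightarrow> 'b set \<Rightarrow> 'b set \<Rightarrow> bool"
  assumes fin: "finite G"
    and cover: "\<And>S R. S \<subseteq> X \<Longrightarrow> R \<subseteq> X \<Longrightarrow> S \<inter> R = {} \<longleftrightarrow> (\<exists>g\<in>G. P g S R)"
    and rectangle: "\<And>g S R S' R'. g \<in> G \<Longrightarrow> P g S R \<Longrightarrow> P g S' R' \<Longrightarrow> P g S R'"
  shows "2 ^ card X \<le> card G"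
proof (cases "finite X")
  \<comment> \<open>For infinite \<open>X\<close> the cardinality is 0 by convention, so one
    rectangle is enough.\<close>
  case False
  moreover have "\<exists>g\<in>G. P g {} {}"
    using cover[of "{}" "{}"] by simp
  ultimately show ?thesis
    using fin by (auto simp: Suc_le_eq card_gt_0_iff)
next
  case True
  have "\<forall>S\<in>Pow X. \<exists>g\<in>G. P g S (X - S)"
  proof
    fix S assume "S \<in> Pow X"
    then show "\<exists>g\<in>G. P g S (X - S)"
      using cover[of S "X - S"] by auto
  qed
  then obtain f where f: "\<And>S. S \<subseteq> X \<Longrightarrow> f S \<in> G \<and> P (f S) S (X - S)"
    unfolding Pow_iff Ball_def by metis
  have "S \<subseteq> S'" if "S \<subseteq> X" "S' \<subseteq> X" "f S = f S'" for S S'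
  proof -
    \<comment> \<open>If one rectangle served both \<open>S\<close> and \<open>S'\<close>, it would
      also contain this mixed pair, which must then be disjoint.\<close>
    have "P (f S) S (X - S')"
      using that f rectangle by metis
    then have "S \<inter> (X - S') = {}"
      using cover[of S "X - S'"] f that by blast
    then show ?thesis
      using that by blast
  qed
  then have "inj_on f (Pow X)"
    by (intro inj_onI) (metis PowD subset_antisym)
  moreover have "f ` Pow X \<subseteq> G"
    using f by auto
  ultimately have "card (Pow X) \<le> card G"
    using fin card_inj_on_le by blast
  then show ?thesis
    using True by (simp add: card_Pow)
qed


section \<open>Rectangle covers from structured circuits\<close>

lemma input_in_gates:
  assumes "boolean_circuit C" "h \<in> inputs C g"
  shows "h \<in> gates C" "g \<in> gates C"
proof -
  have "wires C \<subseteq> gates C \<times> gates C"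
    using assms by (simp add: boolean_circuit_def)
  then show "h \<in> gates C" "g \<in> gates C"
    using assms(2) by (auto simp: inputs_def)
qed

lemma Vars_input_subset:
  assumes "h \<in> inputs C g"
  shows "Vars C h \<subseteq> Vars C g"
proof
  fix x assume "x \<in> Vars C h"
  moreover have "(h, g) \<in> wires C"
    using assms by (simp add: inputs_def)
  ultimately show "x \<in> Vars C g"
    unfolding Vars_def by (blast intro: rtrancl.rtrancl_into_rtrancl)
qed

lemma Vars_eq_inputs:
  assumes "gate_type C g \<noteq> VarGate"
  shows "Vars C g = (\<Union>h\<in>inputs C g. Vars C h)"
proof
  show "Vars C g \<subseteq> (\<Union>h\<in>inputs C g. Vars C h)"
  proof
    fix x assume "x \<in> Vars C g"
    then have "x \<in> var_gates C" "(x, g) \<in> (wires C)\<^sup>*" "x \<noteq> g"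
      using assms by (auto simp: Vars_def var_gates_def)
    then show "x \<in> (\<Union>h\<in>inputs C g. Vars C h)"
      by (auto simp: Vars_def inputs_def elim: rtranclE)
  qed
  show "(\<Union>h\<in>inputs C g. Vars C h) \<subseteq> Vars C g"
    by (intro UN_least Vars_input_subset)
qed

lemma Vars_VarGate:
  assumes "boolean_circuit C" "g \<in> gates C" "gate_type C g = VarGate"
  shows "Vars C g = {g}"
proof -
  have "inputs C g = {}"
    using assms by (auto simp: boolean_circuit_def)
  then show ?thesis
    using assms by (auto simp: Vars_def var_gates_def inputs_def elim: rtranclE)
qed

lemma gate_value_cong:
  assumes C: "boolean_circuit C"
  shows "g \<in> gates C \<Longrightarrow> (\<And>x. x \<in> Vars C g \<Longrightarrow> \<nu> x = \<nu>' x) \<Longrightarrow>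
    gate_value C \<nu> g = gate_value C \<nu>' g"
proof (induction g rule: wf_induct_rule[OF wf_wires[OF C]])
  case (1 g)
  have "gate_value C \<nu> h = gate_value C \<nu>' h" if "h \<in> inputs C g" for h
    using 1 that input_in_gates[OF C that] Vars_input_subset[OF that] by (auto simp: inputs_def)
  moreover have "\<nu> g = \<nu>' g" if "gate_type C g = VarGate"
    using 1 Vars_VarGate[OF C _ that] by simp
  ultimately show ?case
    unfolding gate_value_unfold[OF C, of _ g] by (auto split: gate_type.split)
qed

section \<open>Descent through mixed gates\<close>

text \<open>
  A gate over variables on both sides of \<open>A\<close> is traversed: from an or-gate to any input, from an
  and-gate to the input that still depends on \<open>A\<close>, provided the other input, which depends only
  on variables outside of \<open>A\<close>, is true.
\<close>

definition mixed :: "'g circuit \<Rightarrow> 'g set \<Rightarrow> 'g \<Rightarrow> bool" where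
  "mixed C A g \<longleftrightarrow> g \<in> gates C \<and> Vars C g \<inter> A \<noteq> {} \<and> \<not> Vars C g \<subseteq> A"

definition descent :: "'g circuit \<Rightarrow> 'g set \<Rightarrow> ('g \<Rightarrow> bool) \<Rightarrow> ('g \<times> 'g) set" where
  "descent C A \<nu> = {(g, h). mixed C A g \<and> h \<in> inputs C g \<and>
     (gate_type C g = AndGate \<longrightarrow>
        Vars C h \<inter> A \<noteq> {} \<and> (\<forall>h'\<in>inputs C g - {h}. gate_value C \<nu> h'))}"

text \<open>This is the rectangle of the gate \<open>t\<close>: the path to \<open>t\<close> is
  decided by the values outside \<open>A\<close>, while \<open>t\<close> itself depends on one side
  of \<open>A\<close> only.\<close>

definition accepts_via :: "'g circuit \<Rightarrow> 'g set \<Rightarrow> 'g \<Rightarrow> ('g \<Rightarrow> bool) \<Rightarrow> bool" where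
  "accepts_via C A t \<nu> \<longleftrightarrow>
     \<not> mixed C A t \<and> (output_gate C, t) \<in> (descent C A \<nu>)\<^sup>* \<and> gate_value C \<nu> t"

text \<open>In negation normal form a variable gate or negation depends on a single variable, which
  cannot lie on both sides of \<open>A\<close>.\<close>

lemma mixed_gate_type:
  assumes "is_NNF C" "mixed C A g"
  shows "gate_type C g = OrGate \<or> gate_type C g = AndGate"
proof -
  have C: "boolean_circuit C" and g: "g \<in> gates C"
    using assms by (auto simp: is_NNF_def mixed_def)
  have not_single: "Vars C g \<noteq> {x}" for x
    using assms(2) by (auto simp: mixed_def)
  have "gate_type C g \<noteq> NotGate"
  proof
    assume not: "gate_type C g = NotGate"
    then obtain h where h: "inputs C g = {h}"
      using C g by (auto simp: boolean_circuit_def)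
    then have "h \<in> var_gates C"
      using assms(1) g not by (auto simp: is_NNF_def)
    then have "Vars C h = {h}"
      using Vars_VarGate[OF C] by (auto simp: var_gates_def)
    then show False
      using Vars_eq_inputs[of C g] not h not_single by auto
  qed
  moreover have "gate_type C g \<noteq> VarGate"
    using Vars_VarGate[OF C g] not_single by blast
  ultimately show ?thesis
    by (cases "gate_type C g") auto
qed

text \<open>If \<open>A\<close> met the leaves below both children of the v-tree node, laminarity
  would put all those leaves into \<open>A\<close>, and the gate would not be mixed.\<close>

lemma mixed_and_gate_unique_input:
  assumes C: "structures T C" and A: "n \<in> subtrees T" "A = Leaves n"
    and g: "mixed C A g" "gate_type C g = AndGate"
  shows "\<exists>!h. h \<in> inputs C g \<and> Vars C h \<inter> A \<noteq> {}"
proof -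
  have Vars: "Vars C g = (\<Union>h\<in>inputs C g. Vars C h)"
    using Vars_eq_inputs g by (metis gate_type.distinct(5))
  have ex: "\<exists>h. h \<in> inputs C g \<and> Vars C h \<inter> A \<noteq> {}"
    using g by (auto simp: mixed_def Vars)
  have T: "distinct (leaf_list T)"
    using C by (auto simp: structures_def vtree_over_def)
  from ex have "inputs C g \<noteq> {}"
    by blast
  then obtain m gs where m: "m \<in> subtrees T" "set gs = inputs C g"
    "list_all2 (\<lambda>h n'. Vars C h \<subseteq> Leaves n') gs (children m)"
    using C g unfolding structures_def mixed_def by blast
  show ?thesis
  proof (cases m)
    case (VLeaf x)
    then show ?thesis
      using m ex by auto
  next
    case (VUnary m')
    then obtain h where "gs = [h]"
      using m(3) by (auto simp: list_all2_Cons2)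
    then have "inputs C g = {h}"
      using m(2) by simp
    then show ?thesis
      using ex by auto
  next
    case (VBinary l r)
    then obtain h1 h2 where "gs = [h1, h2]" and h: "Vars C h1 \<subseteq> Leaves l" "Vars C h2 \<subseteq> Leaves r"
      using m(3) by (auto simp: list_all2_Cons2)
    then have inputs: "inputs C g = {h1, h2}"
      using m(2) by simp
    have lr: "l \<in> subtrees T" "r \<in> subtrees T"
      using child_subtree[OF m(1)] VBinary by auto
    have disj: "Leaves l \<inter> Leaves r = {}"
      using subtree_distinct[OF m(1) T] VBinary by (auto simp: Leaves_def)
    have one_side: "\<not> (A \<inter> Leaves l \<noteq> {} \<and> A \<inter> Leaves r \<noteq> {})"
    proof
      assume *: "A \<inter> Leaves l \<noteq> {} \<and> A \<inter> Leaves r \<noteq> {}"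
      then have "Leaves l \<subseteq> A" "Leaves r \<subseteq> A"
        using subtrees_laminar[OF T A(1) lr(1)] subtrees_laminar[OF T A(1) lr(2)] disj A(2)
        by blast+
      then have "Vars C g \<subseteq> A"
        using Vars h inputs by auto
      then show False
        using g by (simp add: mixed_def)
    qed
    have "A \<inter> Leaves l \<noteq> {}" if "Vars C h1 \<inter> A \<noteq> {}"
      using h that by blast
    moreover have "A \<inter> Leaves r \<noteq> {}" if "Vars C h2 \<inter> A \<noteq> {}"
      using h that by blast
    ultimately have "u = w"
      if "u \<in> inputs C g" "w \<in> inputs C g" "Vars C u \<inter> A \<noteq> {}" "Vars C w \<inter> A \<noteq> {}" for u w
      using that inputs one_side by auto
    then show ?thesis
      using ex by (intro ex_ex1I) blast+
  qed
qed

lemma descent_mixed: "(g, h) \<in> descent C A \<nu> \<Longrightarrow> mixed C A g"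
  by (simp add: descent_def)

text \<open>Soundness of the descent: one true input suffices for an or-gate, and at an and-gate the
  relation itself demands that the remaining inputs are true.\<close>

lemma descent_gate_value:
  assumes C: "is_NNF C" and step: "(g, h) \<in> descent C A \<nu>" and h: "gate_value C \<nu> h"
  shows "gate_value C \<nu> g"
proof -
  have "boolean_circuit C"
    using C by (simp add: is_NNF_def)
  moreover have "gate_type C g = OrGate \<or> gate_type C g = AndGate"
    using mixed_gate_type[OF C] step by (auto simp: descent_def)
  ultimately show ?thesis
    using step h by (auto simp: gate_value_unfold[of C \<nu> g] descent_def)
qed

lemma descent_rtrancl_gate_value:
  assumes C: "is_NNF C" and steps: "(g, t) \<in> (descent C A \<nu>)\<^sup>*" and t: "gate_value C \<nu> t"
  shows "gate_value C \<nu> g"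
  using steps
proof (induction rule: converse_rtrancl_induct)
  case (step g h)
  then show ?case
    using descent_gate_value[OF C] by blast
qed (rule t)

locale structured_circuit =
  fixes C :: "'g circuit" and T :: "'g vtree" and n :: "'g vtree" and A :: "'g set"
  assumes NNF: "is_NNF C" and structured: "structures T C"
    and n: "n \<in> subtrees T" and A: "A = Leaves n"
begin

lemma circuit: "boolean_circuit C"
  using NNF by (simp add: is_NNF_def)

text \<open>Completeness of the descent: a true mixed gate always has a true successor, and the path
  stops because the wires are well-founded.\<close>

lemma gate_value_descends:
  "g \<in> gates C \<Longrightarrow> gate_value C \<nu> g \<Longrightarrow>
    \<exists>t\<in>gates C. \<not> mixed C A t \<and> (g, t) \<in> (descent C A \<nu>)\<^sup>* \<and> gate_value C \<nu> t"
proof (induction g rule: wf_induct_rule[OF wf_wires[OF circuit]])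
  case (1 g)
  show ?case
  proof (cases "mixed C A g")
    case True
    have "\<exists>h\<in>inputs C g. gate_value C \<nu> h \<and> (g, h) \<in> descent C A \<nu>"
      using mixed_gate_type[OF NNF True]
    proof
      assume "gate_type C g = OrGate"
      then show ?thesis
        using 1 True by (auto simp: gate_value_unfold[OF circuit, of \<nu> g] descent_def)
    next
      assume g: "gate_type C g = AndGate"
      then have "\<forall>h\<in>inputs C g. gate_value C \<nu> h"
        using 1 by (auto simp: gate_value_unfold[OF circuit, of \<nu> g])
      then show ?thesis
        using mixed_and_gate_unique_input[OF structured n A True g] True
        by (auto simp: descent_def)
    qed
    then obtain h where h: "h \<in> inputs C g" "gate_value C \<nu> h" "(g, h) \<in> descent C A \<nu>"
      by blast
    then show ?thesis
      using 1(1)[of h] input_in_gates[OF circuit h(1)]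
      by (auto simp: inputs_def intro: converse_rtrancl_into_rtrancl)
  qed (use 1 in blast)
qed

lemma accepts_via_cover:
  "gate_value C \<nu> (output_gate C) \<longleftrightarrow> (\<exists>t\<in>gates C. accepts_via C A t \<nu>)"
proof -
  have "output_gate C \<in> gates C"
    using circuit by (simp add: boolean_circuit_def)
  then show ?thesis
    using gate_value_descends[of "output_gate C" \<nu>] descent_rtrancl_gate_value[OF NNF]
    unfolding accepts_via_def by blast
qed

lemma descent_functional:
  assumes "deterministic C"
    and "(g, h) \<in> descent C A \<nu>" "gate_value C \<nu> h"
    and "(g, h') \<in> descent C A \<nu>" "gate_value C \<nu> h'"
  shows "h = h'"
proof -
  have g: "mixed C A g" "h \<in> inputs C g" "h' \<in> inputs C g"
    using assms by (auto simp: descent_def)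
  from mixed_gate_type[OF NNF g(1)] show ?thesis
  proof
    assume "gate_type C g = OrGate"
    then show ?thesis
      using assms(1,3,5) g unfolding deterministic_def mixed_def by blast
  next
    assume and_gate: "gate_type C g = AndGate"
    show ?thesis
      using mixed_and_gate_unique_input[OF structured n A g(1) and_gate] assms(2,4) and_gate
      by (auto simp: descent_def)
  qed
qed

text \<open>Among true gates the descent has at most one successor, so all descents to true gates
  follow one path, and this path cannot continue past a gate that is not mixed.\<close>

lemma accepts_via_disjoint:
  assumes det: "deterministic C" and t: "accepts_via C A t \<nu>" and t': "accepts_via C A t' \<nu>"
  shows "t = t'"
proof -
  let ?D = "descent C A \<nu>"
  have stop: "u = v" if "\<not> mixed C A u" "(u, v) \<in> ?D\<^sup>*" for u v
    using that(2)
  proof (cases rule: converse_rtranclE)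
    case base
    then show ?thesis .
  next
    case (step w)
    then show ?thesis
      using that(1) descent_mixed by metis
  qed
  have "(g, t') \<in> ?D\<^sup>* \<longrightarrow> t = t'" if "(g, t) \<in> ?D\<^sup>*" for g
    using that
  proof (induction rule: converse_rtrancl_induct)
    case base
    then show ?case
      using stop t by (auto simp: accepts_via_def)
  next
    case (step g h)
    show ?case
    proof
      assume gt': "(g, t') \<in> ?D\<^sup>*"
      have "g \<noteq> t'"
        using descent_mixed[OF step(1)] t' by (auto simp: accepts_via_def)
      with gt' obtain h' where h': "(g, h') \<in> ?D" "(h', t') \<in> ?D\<^sup>*"
        by (metis converse_rtranclE)
      \<comment> \<open>Truth of the end points \<open>t\<close> and \<open>t'\<close> propagates
        back along the paths, as functionality holds only between true gates.\<close>
      have "gate_value C \<nu> h" "gate_value C \<nu> h'"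
        using descent_rtrancl_gate_value[OF NNF] step(2) h'(2) t t'
        by (auto simp: accepts_via_def)
      then have "h = h'"
        using descent_functional[OF det step(1) _ h'(1)] by blast
      then show "t = t'"
        using step h' by blast
    qed
  qed
  then show ?thesis
    using t t' by (auto simp: accepts_via_def)
qed

text \<open>The only values the descent consults are those of the side inputs of and-gates, and
  these have no variable in \<open>A\<close>.\<close>

lemma descent_cong:
  assumes "\<And>x. x \<notin> A \<Longrightarrow> \<nu> x = \<nu>' x"
  shows "descent C A \<nu> \<subseteq> descent C A \<nu>'"
proof (rule subrelI)
  fix g h assume gh: "(g, h) \<in> descent C A \<nu>"
  have "gate_value C \<nu>' h'"
    if "gate_type C g = AndGate" "h' \<in> inputs C g - {h}" for h'
  proof -
    have "Vars C h' \<inter> A = {}"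
      using mixed_and_gate_unique_input[OF structured n A _ that(1)] gh that
      by (auto simp: descent_def)
    then have "gate_value C \<nu> h' = gate_value C \<nu>' h'"
      using assms that input_in_gates[OF circuit] by (intro gate_value_cong[OF circuit]) auto
    then show ?thesis
      using gh that by (auto simp: descent_def)
  qed
  then show "(g, h) \<in> descent C A \<nu>'"
    using gh by (auto simp: descent_def)
qed

text \<open>The glued valuation inherits the path from \<open>\<nu>'\<close> and the value of
  \<open>t\<close> from the valuation on whichever side \<open>t\<close> depends.\<close>

lemma accepts_via_rectangle:
  assumes t: "t \<in> gates C" "accepts_via C A t \<nu>" "accepts_via C A t \<nu>'"
  shows "accepts_via C A t (\<lambda>x. if x \<in> A then \<nu> x else \<nu>' x)" (is "accepts_via C A t ?\<mu>")
proof -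
  have "descent C A \<nu>' \<subseteq> descent C A ?\<mu>"
    by (rule descent_cong) simp
  then have "(output_gate C, t) \<in> (descent C A ?\<mu>)\<^sup>*"
    using t(3) rtrancl_mono unfolding accepts_via_def by blast
  moreover have "gate_value C ?\<mu> t"
  proof -
    have "Vars C t \<subseteq> A \<or> Vars C t \<inter> A = {}"
      using t by (auto simp: accepts_via_def mixed_def)
    then show ?thesis
    proof
      assume "Vars C t \<subseteq> A"
      then have "gate_value C ?\<mu> t = gate_value C \<nu> t"
        using t(1) by (intro gate_value_cong[OF circuit]) auto
      then show ?thesis
        using t by (simp add: accepts_via_def)
    next
      assume "Vars C t \<inter> A = {}"
      then have "gate_value C ?\<mu> t = gate_value C \<nu>' t"
        using t(1) by (intro gate_value_cong[OF circuit]) auto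
      then show ?thesis
        using t by (simp add: accepts_via_def)
    qed
  qed
  ultimately show ?thesis
    using t by (simp add: accepts_via_def)
qed

end


section \<open>Independent crossing clauses\<close>

text \<open>Greedy choice: pick \<open>x\<close>, discard it and its neighbours, at most
  \<open>b\<close> elements in all, and recurse on the rest.\<close>

lemma independent_subset_exists:
  assumes "finite S" and sym: "\<And>x y. R x y \<Longrightarrow> R y x"
    and bound: "\<And>x. x \<in> S \<Longrightarrow> card {y \<in> S. y = x \<or> R x y} \<le> b"
  shows "\<exists>X\<subseteq>S. (\<forall>x\<in>X. \<forall>y\<in>X. R x y \<longrightarrow> x = y) \<and> card S \<le> b * card X"
  using assms(1) bound
proof (induction "card S" arbitrary: S rule: less_induct)
  case less
  show ?case
  proof (cases "S = {}")
    case False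
    then obtain x where x: "x \<in> S"
      by blast
    let ?N = "{y \<in> S. y = x \<or> R x y}"
    have smaller: "card (S - ?N) < card S"
      using x less.prems(1) by (intro psubset_card_mono) auto
    have "card {z \<in> S - ?N. z = y \<or> R y z} \<le> b" if "y \<in> S - ?N" for y
    proof -
      have "card {z \<in> S - ?N. z = y \<or> R y z} \<le> card {z \<in> S. z = y \<or> R y z}"
        using less.prems(1) by (intro card_mono) auto
      also have "\<dots> \<le> b"
        using less.prems(2) that by blast
      finally show ?thesis .
    qed
    then obtain X where X: "X \<subseteq> S - ?N" "\<forall>x\<in>X. \<forall>y\<in>X. R x y \<longrightarrow> x = y"
      "card (S - ?N) \<le> b * card X"
      using less.hyps[OF smaller] less.prems(1) by auto
    have finX: "finite X" "x \<notin> X"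
      using X(1) less.prems(1) by (auto intro: finite_subset)
    have "card S \<le> card ?N + card (S - ?N)"
      using less.prems(1) by (subst card_Diff_subset) (auto intro: card_mono)
    also have "\<dots> \<le> b + b * card X"
      using less.prems(2)[OF x] X(3) by simp
    also have "\<dots> = b * card (insert x X)"
      using finX by simp
    finally have "card S \<le> b * card (insert x X)" .
    moreover have "\<not> R x y \<and> \<not> R y x" if "y \<in> X" for y
      using X(1) that sym[of y x] by blast
    then have "\<forall>y\<in>insert x X. \<forall>z\<in>insert x X. R y z \<longrightarrow> y = z"
      using X(2) by auto
    ultimately show ?thesis
      using X(1) x by (intro exI[of _ "insert x X"]) auto
  qed simp
qed

text \<open>Disjointness of the chosen clauses would be too weak: a further clause of
  \<open>F\<close> could be assembled from pieces of several of them. Unlinked clauses exclude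
  this.\<close>

definition linked :: "'v set set \<Rightarrow> 'v set \<Rightarrow> 'v set \<Rightarrow> bool" where
  "linked F K L \<longleftrightarrow> (\<exists>M\<in>F. M \<inter> K \<noteq> {} \<and> M \<inter> L \<noteq> {})"

lemma linked_self: "K \<in> F \<Longrightarrow> K \<noteq> {} \<Longrightarrow> linked F K K"
  by (auto simp: linked_def)

text \<open>A linked clause is reached by choosing a vertex of \<open>K\<close>, a clause through
  it, a vertex of that clause and a clause through that vertex, with at most \<open>a\<close>,
  \<open>d\<close>, \<open>a\<close> and \<open>d\<close> options.\<close>

lemma card_linked_le:
  assumes "finite V" "F \<subseteq> Pow V" "K \<in> F"
    and arity: "\<And>L. L \<in> F \<Longrightarrow> card L \<le> a"
    and degree: "\<And>x. x \<in> V \<Longrightarrow> card {L \<in> F. x \<in> L} \<le> d"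
  shows "card {L \<in> F. linked F K L} \<le> a ^ 2 * d ^ 2"
proof -
  let ?B = "\<Union>x\<in>K. \<Union>M\<in>{M \<in> F. x \<in> M}. \<Union>y\<in>M. {L \<in> F. y \<in> L}"
  have finF: "finite F"
    using assms(1,2) by (intro finite_subset[of F "Pow V"]) auto
  have fin: "finite L" "L \<subseteq> V" if "L \<in> F" for L
    using that assms(1,2) by (auto intro: finite_subset)
  have "card ?B \<le> a * (d * (a * d))"
    using finF fin assms(3) by (intro card_UN_le_mult arity degree) auto
  moreover have "card {L \<in> F. linked F K L} \<le> card ?B"
  proof (rule card_mono)
    show "finite ?B"
      by (rule finite_subset[OF _ finF]) auto
    show "{L \<in> F. linked F K L} \<subseteq> ?B"
      by (auto simp: linked_def)
  qed
  ultimately show ?thesis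
    by (simp add: power2_eq_square mult_ac)
qed

definition sides_valuation :: "'v set \<Rightarrow> 'v set set \<Rightarrow> 'v set set \<Rightarrow> 'v \<Rightarrow> bool" where
  "sides_valuation A S R x \<longleftrightarrow> (if x \<in> A then x \<in> \<Union>S else x \<in> \<Union>R)"

text \<open>A satisfied clause is covered by clauses of \<open>X\<close>, by independence by a
  single one, and equals it by minimality. It crosses \<open>A\<close>, so its inner part forces it
  into \<open>S\<close> and its outer part into \<open>R\<close>.\<close>

lemma dnf_value_sides_valuation:
  assumes antichain: "\<And>K L. K \<in> F \<Longrightarrow> L \<in> F \<Longrightarrow> K \<subseteq> L \<Longrightarrow> K = L" and "{} \<notin> F"
    and X: "X \<subseteq> crossing F A" and indep: "\<And>K L. K \<in> X \<Longrightarrow> L \<in> X \<Longrightarrow> linked F K L \<Longrightarrow> K = L"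
    and SR: "S \<subseteq> X" "R \<subseteq> X"
  shows "dnf_value F (sides_valuation A S R) \<longleftrightarrow> S \<inter> R \<noteq> {}"
proof
  have XF: "X \<subseteq> F"
    using X by (auto simp: crossing_def)
  assume "S \<inter> R \<noteq> {}"
  then obtain K where "K \<in> S" "K \<in> R"
    by blast
  then show "dnf_value F (sides_valuation A S R)"
    using SR XF by (auto simp: dnf_value_def sides_valuation_def intro!: bexI[of _ K])
next
  have XF: "X \<subseteq> F"
    using X by (auto simp: crossing_def)
  assume "dnf_value F (sides_valuation A S R)"
  then obtain K where K: "K \<in> F" "\<forall>x\<in>K. sides_valuation A S R x"
    by (auto simp: dnf_value_def)
  have cover: "\<exists>L\<in>X. x \<in> L" if "x \<in> K" for x
  proof -
    have "x \<in> \<Union>S \<or> x \<in> \<Union>R"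
      using bspec[OF K(2) that] by (cases "x \<in> A") (simp_all add: sides_valuation_def)
    then show ?thesis
      using SR by blast
  qed
  obtain x where x: "x \<in> K"
    using K \<open>{} \<notin> F\<close> by fastforce
  then obtain L where L: "L \<in> X" "x \<in> L"
    using cover by blast
  have "y \<in> L" if y: "y \<in> K" for y
  proof -
    obtain M where M: "M \<in> X" "y \<in> M"
      using cover[OF y] by blast
    have "linked F L M"
      using K(1) x L y M by (auto simp: linked_def)
    then show ?thesis
      using indep L M by blast
  qed
  then have "K = L"
    using antichain[of K L] K L XF by blast
  \<comment> \<open>The only clause of \<open>X\<close> that meets \<open>K\<close> is
    \<open>K\<close> itself.\<close>
  have mem: "K \<in> Y" if y: "y \<in> K" "y \<in> \<Union>Y" "Y \<subseteq> X" for y Y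
  proof -
    obtain M where M: "M \<in> Y" "y \<in> M"
      using y by blast
    then have "linked F K M"
      using K(1) y by (auto simp: linked_def)
    then show ?thesis
      using indep[of K M] L M y \<open>K = L\<close> by blast
  qed
  obtain y z where "y \<in> K" "y \<in> A" "z \<in> K" "z \<notin> A"
  proof -
    have "L \<inter> A \<noteq> {}" "\<not> L \<subseteq> A"
      using X L(1) by (auto simp: crossing_def)
    then show ?thesis
      using that \<open>K = L\<close> by blast
  qed
  then have "K \<in> S" "K \<in> R"
    using K(2) mem[of y S] mem[of z R] SR by (auto simp: sides_valuation_def)
  then show "S \<inter> R \<noteq> {}"
    by blast
qed

lemma many_independent_crossing_clauses:
  assumes F: "monotone_normal_form V F" and T: "vtree_over T V"
  obtains n X where "n \<in> subtrees T" "X \<subseteq> crossing F (Leaves n)"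
    "\<And>K L. K \<in> X \<Longrightarrow> L \<in> X \<Longrightarrow> linked F K L \<Longrightarrow> K = L"
    "treewidth V F div (3 * arity F ^ 3 * degree V F ^ 2) \<le> card X"
proof -
  let ?a = "arity F" and ?d = "degree V F"
  have V: "finite V" "F \<subseteq> Pow V" and empty: "{} \<notin> F"
    using F by (auto simp: monotone_normal_form_def)
  have finF: "finite F"
    using V by (intro finite_subset[of F "Pow V"]) auto
  have a: "card K \<le> ?a" if "K \<in> F" for K
    using that finF by (auto simp: arity_def)
  have d: "card {K \<in> F. x \<in> K} \<le> ?d" if "x \<in> V" for x
    using that V by (auto simp: degree_def)
  interpret binary_laminar V "Leaves ` subtrees T"
    by (rule vtree_binary_laminar[OF T])
  let ?s = "Max ((\<lambda>A. card (crossing F A)) ` Leaves ` subtrees T)"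
  have "?s \<in> (\<lambda>A. card (crossing F A)) ` Leaves ` subtrees T"
    using finite_family top by (intro Max_in) auto
  then obtain n where n: "n \<in> subtrees T" "?s = card (crossing F (Leaves n))"
    by blast
  have tw: "treewidth V F \<le> 2 * ?a * ?s"
    using treewidth_le_crossing[OF V(2) empty a, of ?s] finite_family by simp
  have "card {L \<in> crossing F (Leaves n). L = K \<or> linked F K L} \<le> ?a ^ 2 * ?d ^ 2"
    if "K \<in> crossing F (Leaves n)" for K
  proof -
    have K: "K \<in> F" "K \<noteq> {}"
      using that by (auto simp: crossing_def)
    have "card {L \<in> crossing F (Leaves n). L = K \<or> linked F K L} \<le> card {L \<in> F. linked F K L}"
      using finF linked_self[OF K] by (intro card_mono) (auto simp: crossing_def)
    also have "\<dots> \<le> ?a ^ 2 * ?d ^ 2"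
      using card_linked_le[OF V K(1) a d] .
    finally show ?thesis .
  qed
  moreover have "linked F L K" if "linked F K L" for K L
    using that by (auto simp: linked_def)
  moreover have "finite (crossing F (Leaves n))"
    using finF by (simp add: crossing_def)
  ultimately obtain X where X: "X \<subseteq> crossing F (Leaves n)"
    "\<forall>K\<in>X. \<forall>L\<in>X. linked F K L \<longrightarrow> K = L"
    "card (crossing F (Leaves n)) \<le> ?a ^ 2 * ?d ^ 2 * card X"
    using independent_subset_exists[of "crossing F (Leaves n)" "linked F" "?a ^ 2 * ?d ^ 2"]
    by blast
  have "treewidth V F \<le> 2 * ?a * (?a ^ 2 * ?d ^ 2 * card X)"
    using tw X(3) n(2) by (metis mult_le_mono2 order_trans)
  \<comment> \<open>The constant 2 from the two halves of a bag is relaxed to 3.\<close>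
  also have "\<dots> \<le> (3 * ?a ^ 3 * ?d ^ 2) * card X"
    by (simp add: power3_eq_cube power2_eq_square mult_ac)
  finally have "treewidth V F div (3 * ?a ^ 3 * ?d ^ 2)
      \<le> ((3 * ?a ^ 3 * ?d ^ 2) * card X) div (3 * ?a ^ 3 * ?d ^ 2)"
    by (rule div_le_mono)
  also have "\<dots> \<le> card X"
  proof -
    have "c * m div c \<le> m" for c m :: nat
      by (cases "c = 0") auto
    then show ?thesis .
  qed
  finally show ?thesis
    using that n(1) X(1,2) by blast
qed

section \<open>The lower bounds\<close>

context structured_circuit
begin

text \<open>The parameter \<open>f\<close> is the identity for DNFs and negation for CNFs, so that
  one statement serves both covers.\<close>

lemma accepts_via_sides_rectangle:
  assumes "t \<in> gates C"
    and "accepts_via C A t (\<lambda>x. f (sides_valuation A S R x))"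
    and "accepts_via C A t (\<lambda>x. f (sides_valuation A S' R' x))"
  shows "accepts_via C A t (\<lambda>x. f (sides_valuation A S R' x))"
proof -
  have "(\<lambda>x. if x \<in> A then f (sides_valuation A S R x) else f (sides_valuation A S' R' x)) =
      (\<lambda>x. f (sides_valuation A S R' x))"
    by (auto simp: sides_valuation_def)
  then show ?thesis
    using accepts_via_rectangle[OF assms] by simp
qed

lemma finite_gates: "finite (gates C)"
  using circuit by (simp add: boolean_circuit_def)

end

theorem theorem25:
  fixes V :: "'v set" and F :: "'v set set" and C :: "'v circuit"
  assumes "monotone_normal_form V F"
  shows "(is_d_SDNNF C \<and> captures C V (dnf_value F) \<longrightarrow>
            2 ^ (treewidth V F div (3 * arity F ^ 3 * degree V F ^ 2)) - 1 \<le> circuit_size C) \<and>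
         (is_SDNNF C \<and> captures C V (cnf_value F) \<longrightarrow>
            2 ^ (treewidth V F div (3 * arity F ^ 3 * degree V F ^ 2)) - 1 \<le> circuit_size C)"
proof -
  let ?k = "treewidth V F div (3 * arity F ^ 3 * degree V F ^ 2)"
  have fin: "finite V" "F \<subseteq> Pow V" and empty: "{} \<notin> F"
    and antichain: "\<And>K L. K \<in> F \<Longrightarrow> L \<in> F \<Longrightarrow> K \<subseteq> L \<Longrightarrow> K = L"
    using assms by (auto simp: monotone_normal_form_def)
  have bound: "2 ^ ?k - 1 \<le> circuit_size C"
    if C: "is_SDNNF C" "var_gates C = V"
      and f: "deterministic C \<and> captures C V (dnf_value F) \<or> captures C V (cnf_value F)"
  proof -
    obtain T where T: "structures T C"
      using C by (auto simp: is_SDNNF_def)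
    then have "vtree_over T V"
      using C by (simp add: structures_def)
    from many_independent_crossing_clauses[OF assms this] obtain n X where
      n: "n \<in> subtrees T" and X: "X \<subseteq> crossing F (Leaves n)"
        "\<And>K L. K \<in> X \<Longrightarrow> L \<in> X \<Longrightarrow> linked F K L \<Longrightarrow> K = L"
      and k: "?k \<le> card X"
      by blast
    interpret structured_circuit C T n "Leaves n"
      using C T n by unfold_locales (auto simp: is_SDNNF_def)
    have finX: "finite X"
    proof (rule finite_subset)
      show "X \<subseteq> Pow V"
        using X(1) fin(2) by (auto simp: crossing_def)
    qed (use fin in simp)
    have dnf: "dnf_value F (sides_valuation (Leaves n) S R) \<longleftrightarrow> S \<inter> R \<noteq> {}"
      if "S \<subseteq> X" "R \<subseteq> X" for S R
      by (rule dnf_value_sides_valuation[OF _ empty X(1) _ that]) (use antichain X(2) in blast)+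
    note rectangle = accepts_via_sides_rectangle[where f = "\<lambda>b. b"]
      accepts_via_sides_rectangle[where f = Not]
    have "2 ^ card X - 1 \<le> card (gates C)"
      using f
    proof
      assume f: "deterministic C \<and> captures C V (dnf_value F)"
      let ?P = "\<lambda>t S R. accepts_via C (Leaves n) t (\<lambda>x. sides_valuation (Leaves n) S R x)"
      show ?thesis
      proof (rule disjoint_rectangle_cover_intersects[where P = ?P])
        show "S \<inter> R \<noteq> {} \<longleftrightarrow> (\<exists>t\<in>gates C. ?P t S R)" if "S \<subseteq> X" "R \<subseteq> X" for S R
          using f dnf[OF that] accepts_via_cover unfolding captures_def by metis
        show "t = t'" if "?P t S R" "?P t' S R" for t t' S R
          using f that accepts_via_disjoint by blast
      qed (use finX finite_gates rectangle(1) in blast)+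
    next
      assume f: "captures C V (cnf_value F)"
      \<comment> \<open>By De Morgan the CNF under the negated valuation is the negation of the DNF,
        so the accepted pairs are the disjoint ones. The fooling set allows overlapping rectangles,
        hence no determinism is assumed in this case.\<close>
      let ?P = "\<lambda>t S R. accepts_via C (Leaves n) t (\<lambda>x. \<not> sides_valuation (Leaves n) S R x)"
      have "2 ^ card X \<le> card (gates C)"
      proof (rule rectangle_cover_disjoint_sets[where P = ?P])
        show "S \<inter> R = {} \<longleftrightarrow> (\<exists>t\<in>gates C. ?P t S R)" if "S \<subseteq> X" "R \<subseteq> X" for S R
        proof -
          have "cnf_value F (\<lambda>x. \<not> sides_valuation (Leaves n) S R x) \<longleftrightarrow>
              \<not> dnf_value F (sides_valuation (Leaves n) S R)"
            by (auto simp: cnf_value_def dnf_value_def)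
          then show ?thesis
            using f dnf[OF that] accepts_via_cover unfolding captures_def by metis
        qed
      qed (use finite_gates rectangle(2) in blast)+
      then show ?thesis
        by simp
    qed
    moreover have "(2::nat) ^ ?k - 1 \<le> 2 ^ card X - 1"
      using k by (intro diff_le_mono power_increasing) auto
    ultimately show ?thesis
      by (simp add: circuit_size_def)
  qed
  then show ?thesis
    unfolding is_d_SDNNF_def captures_def by blast
qed

end
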